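(* Let $n$ and $k$ be integers with $2\leqslant k\leqslant n-1$. Then $$|\mathcal{P}_n^{k-1}[n\prec 1]|=(2n-k)\,|\mathcal{P}_n^{k}[n\prec 1]|.$$
   Context: A labeled plane tree is a rooted labeled tree in which the children of every vertex are linearly ordered. Write $[n]=\{1,\ldots,n\}$. For $1\leqslant k\leqslant n$, $\mathcal{P}_n^k$ denotes the set of forests with vertex set $[n]$ that consist of exactly $k$ labeled plane trees whose roots are $1,\ldots,k$ respectively. A vertex $y$ of a forest is a descendant of $x$, written $y\prec x$, if $x$ lies on the path from the root of the tree containing $y$ to $y$. $\mathcal{P}_n^k[n\prec 1]$ denotes the subset of those forests in $\mathcal{P}_n^k$ in which $n\prec 1$, i.e. vertex $n$ lies in the tree rooted at $1$. *)

theory Defs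
  imports Main
begin

text \<open>A rooted plane tree with labelled vertices: the order of the children of a vertex is the
  order of the list.\<close>

datatype 'a plane_tree = Node (root: 'a) (children: "'a plane_tree list")

text \<open>All vertex labels in preorder, with multiplicity; a labelled tree is one in which no label
  is repeated.\<close>

primrec labels :: "'a plane_tree \<Rightarrow> 'a list" where
  "labels (Node x ts) = x # concat (map labels ts)"

text \<open>A forest of \<open>k\<close> trees with roots \<open>1, \<dots>, k\<close> carries no order among its trees. Since the
  roots identify the trees, it is represented by the list of its trees sorted by root.\<close>

definition plane_forests :: "nat \<Rightarrow> nat \<Rightarrow> nat plane_tree list set" where
  "plane_forests n k =
    {F. map root F = [1..<Suc k] \<and>
        distinct (concat (map labels F)) \<and>
        set (concat (map labels F)) = {1..n}}"

text \<open>\<open>root_path t p\<close>: \<open>p\<close> is the sequence of vertices on the path in \<open>t\<close> leading from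
  its root down to the vertex \<open>last p\<close>.\<close>

inductive root_path :: "'a plane_tree \<Rightarrow> 'a list \<Rightarrow> bool" where
  "root_path (Node x ts) [x]"
| "t \<in> set ts \<Longrightarrow> root_path t p \<Longrightarrow> root_path (Node x ts) (x # p)"

text \<open>\<open>descendant F y x\<close> is the relation $y \prec x$ in the forest \<open>F\<close>; it is reflexive on
  the vertices of \<open>F\<close>.\<close>

definition descendant :: "'a plane_tree list \<Rightarrow> 'a \<Rightarrow> 'a \<Rightarrow> bool" where
  "descendant F y x \<longleftrightarrow> (\<exists>t \<in> set F. \<exists>p. root_path t p \<and> last p = y \<and> x \<in> set p)"

definition plane_forests_desc :: "nat \<Rightarrow> nat \<Rightarrow> nat \<Rightarrow> nat \<Rightarrow> nat plane_tree list set" where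
  "plane_forests_desc n k y x = {F \<in> plane_forests n k. descendant F y x}"

end

theory Submission
  imports Defs "HOL-Library.Multiset"
begin

text \<open>Every forest with roots \<open>1, \<dots>, k - 1\<close> arises from exactly one forest with roots
  \<open>1, \<dots>, k\<close> by grafting the tree rooted at \<open>k\<close> onto one of the others. A tree with \<open>m\<close>
  vertices offers \<open>2 m - 1\<close> places for this. The result has \<open>n \<prec> 1\<close> if either \<open>n\<close> was
  already below \<open>1\<close>, so that all \<open>2 (n - m\<^sub>k) - (k - 1)\<close> places are allowed (\<open>m\<^sub>i\<close> being the
  size of the tree rooted at \<open>i\<close>), or \<open>n\<close> was below \<open>k\<close> and the tree was grafted onto the
  first one, at one of \<open>2 m\<^sub>1 - 1\<close> places. Exchanging the children of \<open>1\<close> and \<open>k\<close> turns the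
  second count into \<open>2 m\<^sub>k - 1\<close> over the forests with \<open>n \<prec> 1\<close>, and the two counts add up to
  the constant \<open>2 n - k\<close>.\<close>

section \<open>Induction on forests and finiteness\<close>

abbreviation forest_labels :: "'a plane_tree list \<Rightarrow> 'a list" where
  "forest_labels F \<equiv> concat (map labels F)"

lemma root_in_labels: "root t \<in> set (labels t)"
  by (cases t) simp

lemma labels_neq_Nil [simp]: "labels t \<noteq> []"
  by (cases t) simp

text \<open>A nonempty forest splits into the first root, the children of that root and the
  remaining trees, as in the first-child/next-sibling encoding. Both lists have fewer labels, so
  lists of children and forests can be treated alike.\<close>

lemma forest_induct [case_names Nil Cons]:
  assumes "P []" and "\<And>x us ts. P us \<Longrightarrow> P ts \<Longrightarrow> P (Node x us # ts)"
  shows "P F"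
proof (induction "length (forest_labels F)" arbitrary: F rule: less_induct)
  case less
  show ?case
  proof (cases F)
    case Nil
    then show ?thesis using assms(1) by simp
  next
    case (Cons t ts)
    obtain x us where t: "t = Node x us" by (cases t)
    show ?thesis unfolding Cons t
      by (intro assms(2) less) (simp_all add: Cons t)
  qed
qed

text \<open>Bounding the number of labels instead of fixing it lets one induction hypothesis cover
  both parts of a nonempty forest, whatever their sizes.\<close>

lemma finite_forests:
  assumes "finite A"
  shows "finite {F. length (forest_labels F) \<le> m \<and> set (forest_labels F) \<subseteq> A}"
proof (induction m)
  case 0
  have "F = []" if "length (forest_labels F) \<le> 0" for F :: "'a plane_tree list"
    using that by (cases F) auto
  then have "{F. length (forest_labels F) \<le> 0 \<and> set (forest_labels F) \<subseteq> A} \<subseteq> {[]}"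
    by blast
  then show ?case by (rule finite_subset) simp
next
  case (Suc m)
  let ?X = "{F. length (forest_labels F) \<le> m \<and> set (forest_labels F) \<subseteq> A}"
  have "F \<in> insert [] ((\<lambda>(x, us, ts). Node x us # ts) ` (A \<times> ?X \<times> ?X))"
    if F: "length (forest_labels F) \<le> Suc m" "set (forest_labels F) \<subseteq> A" for F
  proof (cases F)
    case (Cons t ts)
    obtain x us where t: "t = Node x us" by (cases t)
    have "(x, us, ts) \<in> A \<times> ?X \<times> ?X" using F by (auto simp: Cons t)
    then have "(\<lambda>(x, us, ts). Node x us # ts) (x, us, ts)
        \<in> (\<lambda>(x, us, ts). Node x us # ts) ` (A \<times> ?X \<times> ?X)"
      by (rule imageI)
    then show ?thesis by (simp add: Cons t)
  qed simp
  then have "{F. length (forest_labels F) \<le> Suc m \<and> set (forest_labels F) \<subseteq> A}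
      \<subseteq> insert [] ((\<lambda>(x, us, ts). Node x us # ts) ` (A \<times> ?X \<times> ?X))"
    by blast
  then show ?case
    by (rule finite_subset) (use assms Suc in auto)
qed

lemma finite_plane_forests: "finite (plane_forests n k)"
proof (rule finite_subset)
  have "length (forest_labels F) = n" if "F \<in> plane_forests n k" for F
    using that distinct_card[of "forest_labels F"] by (simp add: plane_forests_def)
  then show "plane_forests n k
      \<subseteq> {F. length (forest_labels F) \<le> n \<and> set (forest_labels F) \<subseteq> {1..n}}"
    by (auto simp: plane_forests_def)
qed (rule finite_forests, simp)

section \<open>Descendants of a root as members of its tree\<close>

lemma root_path_subset: "root_path t p \<Longrightarrow> p \<noteq> [] \<and> set p \<subseteq> set (labels t)"
  by (induction rule: root_path.induct) auto

lemma root_in_root_path: "root_path t p \<Longrightarrow> root t \<in> set p"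
  by (induction rule: root_path.induct) auto

lemma root_path_exists: "y \<in> set (labels t) \<Longrightarrow> \<exists>p. root_path t p \<and> last p = y"
proof (induction t)
  case (Node x ts)
  show ?case
  proof (cases "y = x")
    case True
    then show ?thesis using root_path.intros(1) by (metis last.simps)
  next
    case False
    then obtain t where t: "t \<in> set ts" "y \<in> set (labels t)" using Node.prems by auto
    then obtain p where p: "root_path t p" "last p = y" using Node.IH by blast
    then have "root_path (Node x ts) (x # p)" "last (x # p) = y"
      using root_path.intros(2)[OF t(1)] root_path_subset by auto
    then show ?thesis by blast
  qed
qed

text \<open>Every path starts at the root of its tree, and distinctness keeps \<open>root t\<close>
  out of the other trees, so a path through it lies in \<open>t\<close>.\<close>

lemma descendant_root_hd_iff:
  assumes "distinct (forest_labels (t # ts))"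
  shows "descendant (t # ts) y (root t) \<longleftrightarrow> y \<in> set (labels t)"
proof
  assume "descendant (t # ts) y (root t)"
  then obtain t' p where t': "t' \<in> set (t # ts)" "root_path t' p" "last p = y" "root t \<in> set p"
    by (auto simp: descendant_def)
  then have "root t \<in> set (labels t')" "y \<in> set (labels t')"
    using root_path_subset last_in_set by blast+
  then show "y \<in> set (labels t)"
    using assms t'(1) root_in_labels[of t] by auto
next
  assume "y \<in> set (labels t)"
  then show "descendant (t # ts) y (root t)"
    unfolding descendant_def by (meson list.set_intros(1) root_in_root_path root_path_exists)
qed

lemma plane_forests_desc_eq:
  assumes "1 \<le> k"
  shows "plane_forests_desc n k y 1 = {F \<in> plane_forests n k. y \<in> set (labels (hd F))}"
proof -
  have "descendant F y 1 \<longleftrightarrow> y \<in> set (labels (hd F))" if "F \<in> plane_forests n k" for F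
  proof (cases F)
    case Nil
    then show ?thesis using that assms by (simp add: plane_forests_def)
  next
    case (Cons t ts)
    then have "root t = 1" using that assms by (simp add: plane_forests_def upt_conv_Cons del: upt_Suc)
    then show ?thesis
      using that descendant_root_hd_iff[of t ts y] by (simp add: plane_forests_def Cons)
  qed
  then show ?thesis by (auto simp: plane_forests_desc_def)
qed

section \<open>Grafting: labels, inversion and number of places\<close>

text \<open>The forests obtained from a given one by adding \<open>s\<close> as a new child of some vertex or,
  if \<open>b\<close> holds, possibly as a new tree of its own.\<close>

fun grafts :: "bool \<Rightarrow> 'a plane_tree \<Rightarrow> 'a plane_tree list \<Rightarrow> 'a plane_tree list set" where
  "grafts b s [] = (if b then {[s]} else {})"
| "grafts b s (Node x us # ts) =
    (if b then {s # Node x us # ts} else {})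
    \<union> (\<lambda>us'. Node x us' # ts) ` grafts True s us
    \<union> (\<lambda>ts'. Node x us # ts') ` grafts b s ts"

lemma Nil_notin_grafts: "[] \<notin> grafts b s ts"
  by (cases "(b, s, ts)" rule: grafts.cases) auto

text \<open>This reads the recursion backwards from the result, as inductions on the grafted forest
  require.\<close>

lemma Cons_in_grafts_iff:
  "Node y us # G \<in> grafts b s ts \<longleftrightarrow>
    b \<and> s = Node y us \<and> ts = G
    \<or> (\<exists>us'. ts = Node y us' # G \<and> us \<in> grafts True s us')
    \<or> (\<exists>ts'. ts = Node y us # ts' \<and> G \<in> grafts b s ts')"
  by (cases "(b, s, ts)" rule: grafts.cases) (auto simp: Nil_notin_grafts)

text \<open>The labels of \<open>s\<close> enter the preorder list at an unspecified position, so
  multisets are compared; they determine both the label set and distinctness.\<close>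

lemma mset_grafts:
  "G \<in> grafts b s ts \<Longrightarrow> mset (forest_labels G) = mset (labels s) + mset (forest_labels ts)"
  by (induction b s ts arbitrary: G rule: grafts.induct) (fastforce split: if_splits)+

lemma map_root_grafts: "G \<in> grafts b s ts \<Longrightarrow> \<not> b \<Longrightarrow> map root G = map root ts"
  by (induction b s ts arbitrary: G rule: grafts.induct) auto

lemma set_grafts:
  "G \<in> grafts b s ts \<Longrightarrow> set (forest_labels G) = set (labels s) \<union> set (forest_labels ts)"
  by (metis mset_grafts mset_append mset_eq_setD set_append)

text \<open>The tree \<open>s\<close> is the subtree cut off at an occurrence of \<open>r\<close>.
  If \<open>b\<close> fails, no entire tree of the forest may be cut off, hence the condition on
  \<open>r\<close>.\<close>

lemma grafts_exists:
  "r \<in> set (forest_labels G) \<Longrightarrow> b \<or> r \<notin> root ` set G \<Longrightarrow>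
    \<exists>s ts. root s = r \<and> G \<in> grafts b s ts"
proof (induction G arbitrary: b rule: forest_induct)
  case Nil
  then show ?case by simp
next
  case (Cons x us ts)
  consider "r = x" | "r \<in> set (forest_labels us)" | "r \<in> set (forest_labels ts)"
    using Cons.prems(1) by auto
  then show ?case
  proof cases
    case 1
    then have "Node x us # ts \<in> grafts b (Node x us) ts"
      using Cons.prems(2) by (simp add: Cons_in_grafts_iff)
    then show ?thesis using 1 by (intro exI[of _ "Node x us"] exI[of _ ts]) simp
  next
    case 2
    then show ?thesis using Cons.IH(1)[of True] unfolding Cons_in_grafts_iff by blast
  next
    case 3
    then have "\<exists>s ts'. root s = r \<and> ts \<in> grafts b s ts'"
      using Cons.IH(2)[of b] Cons.prems(2) by auto
    then show ?thesis unfolding Cons_in_grafts_iff by blast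
  qed
qed

lemma grafts_unique:
  "distinct (forest_labels G) \<Longrightarrow> G \<in> grafts b s ts \<Longrightarrow> G \<in> grafts b s' ts' \<Longrightarrow>
    root s = root s' \<Longrightarrow> s = s' \<and> ts = ts'"
proof (induction G arbitrary: b ts ts' rule: forest_induct)
  case Nil
  then show ?case by (simp add: Nil_notin_grafts)
next
  case (Cons x us G)
  have root_in: "root s0 \<in> set (forest_labels H)" if "H \<in> grafts c s0 ts0"
    for H c ts0 and s0 :: "'a plane_tree"
    using set_grafts[OF that] root_in_labels by blast
  \<comment> \<open>The label \<open>root s0\<close> occurs wherever \<open>s0\<close> was inserted.
    By distinctness it therefore reveals which of the three places was used, and \<open>s\<close>
    and \<open>s'\<close> share this label.\<close>
  have inv: "root s0 = x \<and> s0 = Node x us \<and> ts0 = G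
      \<or> root s0 \<in> set (forest_labels us) \<and> (\<exists>us0. ts0 = Node x us0 # G \<and> us \<in> grafts True s0 us0)
      \<or> root s0 \<in> set (forest_labels G) \<and> (\<exists>G0. ts0 = Node x us # G0 \<and> G \<in> grafts b s0 G0)"
    if "Node x us # G \<in> grafts b s0 ts0" for s0 ts0
    using that root_in[of us] root_in[of G] plane_tree.sel(1)[of x us]
    unfolding Cons_in_grafts_iff by blast
  have d: "distinct (forest_labels us)" "distinct (forest_labels G)"
    "x \<notin> set (forest_labels us)" "x \<notin> set (forest_labels G)"
    "set (forest_labels us) \<inter> set (forest_labels G) = {}"
    using Cons.prems(1) by auto
  note s = inv[OF Cons.prems(2)] and s' = inv[OF Cons.prems(3), folded Cons.prems(4)]
  from s consider "root s = x" | "root s \<in> set (forest_labels us)"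
    | "root s \<in> set (forest_labels G)"
    by blast
  then show ?case
  proof cases
    case 1
    then have "root s \<notin> set (forest_labels us)" "root s \<notin> set (forest_labels G)"
      using d by (simp_all del: set_concat)
    then show ?thesis using s s' by blast
  next
    case 2
    then have "root s \<noteq> x" "root s \<notin> set (forest_labels G)" using d by blast+
    then obtain us1 us2 where "ts = Node x us1 # G" "us \<in> grafts True s us1"
      "ts' = Node x us2 # G" "us \<in> grafts True s' us2"
      using s s' by blast
    then show ?thesis using Cons.IH(1) d(1) Cons.prems(4) by blast
  next
    case 3
    then have "root s \<noteq> x" "root s \<notin> set (forest_labels us)" using d by blast+
    then obtain G1 G2 where "ts = Node x us # G1" "G \<in> grafts b s G1"
      "ts' = Node x us # G2" "G \<in> grafts b s' G2"
      using s s' by blast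
    then show ?thesis using Cons.IH(2) d(2) Cons.prems(4) by blast
  qed
qed

lemma self_notin_grafts: "ts \<notin> grafts b s ts"
proof
  assume "ts \<in> grafts b s ts"
  from mset_grafts[OF this] show False by simp
qed

lemma finite_grafts: "finite (grafts b s ts)"
  by (induction b s ts rule: grafts.induct) auto

text \<open>A vertex with c children offers c + 1 gaps. For m vertices in l trees the sum is m + (m
  - l); if \<open>b\<close> holds, l + 1 gaps between whole trees are added. The condition on
  \<open>root s\<close> makes different gaps give different forests.\<close>

lemma card_grafts:
  "root s \<notin> set (forest_labels ts) \<Longrightarrow>
    card (grafts b s ts) + (if b then 0 else length ts)
      = 2 * length (forest_labels ts) + (if b then 1 else 0)"
proof (induction b s ts rule: grafts.induct)
  case (1 b s)
  then show ?case by simp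
next
  case (2 b s x us ts)
  let ?A = "if b then {s # Node x us # ts} else {}"
  let ?B = "(\<lambda>us'. Node x us' # ts) ` grafts True s us"
  let ?C = "(\<lambda>ts'. Node x us # ts') ` grafts b s ts"
  \<comment> \<open>A forest in \<open>?B\<close> and \<open>?C\<close> would have \<open>ts\<close>
    unchanged by a graft, against \<open>self_notin_grafts\<close>; one in \<open>?A\<close> and
    \<open>?C\<close> would force \<open>root s = x\<close>.\<close>
  have "card (grafts b s (Node x us # ts)) = card (?A \<union> ?B) + card ?C"
    unfolding grafts.simps using 2(3)
    by (intro card_Un_disjoint) (auto simp: finite_grafts self_notin_grafts)
  also have "card (?A \<union> ?B) = card ?A + card ?B"
    using 2(3) by (intro card_Un_disjoint) (auto simp: finite_grafts)
  also have "card ?B = card (grafts True s us)"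
    by (intro card_image) (auto simp: inj_on_def)
  also have "card ?C = card (grafts b s ts)"
    by (intro card_image) (auto simp: inj_on_def)
  finally show ?case using 2 by (simp split: if_splits)
qed

section \<open>Plane forests as grafts of forests with one more tree\<close>

lemma snoc_in_plane_forests_iff:
  "F @ [s] \<in> plane_forests n (Suc k) \<longleftrightarrow>
    map root F = [1..<Suc k] \<and> root s = Suc k \<and> distinct (forest_labels F @ labels s) \<and>
    set (forest_labels F @ labels s) = {1..n}"
  by (auto simp: plane_forests_def)

lemma plane_forests_snocE:
  assumes "H \<in> plane_forests n (Suc k)"
  obtains F s where "H = F @ [s]"
  using assms by (cases H rule: rev_cases) (auto simp: plane_forests_def)

lemma grafts_in_plane_forests_iff:
  assumes "G \<in> grafts False s F" "root s = Suc k"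
  shows "G \<in> plane_forests n k \<longleftrightarrow> F @ [s] \<in> plane_forests n (Suc k)"
proof -
  have "mset (forest_labels G) = mset (forest_labels F @ labels s)"
    using mset_grafts[OF assms(1)] by simp
  note mset_eq_imp_distinct_iff[OF this] mset_eq_setD[OF this]
  moreover have "map root G = map root F" using map_root_grafts[OF assms(1)] by simp
  ultimately show ?thesis
    unfolding snoc_in_plane_forests_iff
    by (simp only: plane_forests_def mem_Collect_eq assms(2) simp_thms)
qed

text \<open>The vertex \<open>Suc k\<close> is present because \<open>Suc k \<le> n\<close> and is
  not a root, so its subtree can be cut off and appended as the last tree.\<close>

lemma plane_forests_eq_UN_grafts:
  assumes "Suc k \<le> n"
  shows "plane_forests n k = (\<Union>H\<in>plane_forests n (Suc k). grafts False (last H) (butlast H))"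
proof (intro equalityI subsetI)
  fix G assume G: "G \<in> plane_forests n k"
  then have "map root G = [1..<Suc k]" by (simp only: plane_forests_def mem_Collect_eq)
  from arg_cong[OF this, of set] have "Suc k \<notin> root ` set G" by (simp del: upt_Suc)
  moreover have "Suc k \<in> set (forest_labels G)"
    using G assms by (simp add: plane_forests_def del: set_concat)
  ultimately obtain s F where s: "root s = Suc k" "G \<in> grafts False s F"
    using grafts_exists[of "Suc k" G False] by blast
  then have "F @ [s] \<in> plane_forests n (Suc k)"
    using G grafts_in_plane_forests_iff[OF s(2,1)] by simp
  then show "G \<in> (\<Union>H\<in>plane_forests n (Suc k). grafts False (last H) (butlast H))"
    by (rule UN_I) (simp add: s(2))
next
  fix G assume "G \<in> (\<Union>H\<in>plane_forests n (Suc k). grafts False (last H) (butlast H))"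
  then obtain H where "H \<in> plane_forests n (Suc k)" "G \<in> grafts False (last H) (butlast H)"
    by blast
  moreover from this(1) obtain F s where "H = F @ [s]" by (rule plane_forests_snocE)
  ultimately have "F @ [s] \<in> plane_forests n (Suc k)" "G \<in> grafts False s F" by simp_all
  moreover from this(1) have "root s = Suc k" unfolding snoc_in_plane_forests_iff by blast
  ultimately show "G \<in> plane_forests n k" using grafts_in_plane_forests_iff by metis
qed

lemma grafts_plane_forests_disjoint:
  assumes "H \<in> plane_forests n (Suc k)" "H' \<in> plane_forests n (Suc k)" "H \<noteq> H'"
  shows "grafts False (last H) (butlast H) \<inter> grafts False (last H') (butlast H') = {}"
proof (rule ccontr)
  obtain F s F' s' where H: "H = F @ [s]" "H' = F' @ [s']"
    using assms plane_forests_snocE by metis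
  assume "\<not> ?thesis"
  then obtain G where G: "G \<in> grafts False s F" "G \<in> grafts False s' F'"
    by (auto simp: H)
  have m: "mset (forest_labels G) = mset (forest_labels F @ labels s)"
    using mset_grafts[OF G(1)] by simp
  have "distinct (forest_labels G)" "root s = root s'"
    using assms(1,2) mset_eq_imp_distinct_iff[OF m] unfolding H snoc_in_plane_forests_iff by auto
  then show False using grafts_unique[OF _ G] assms(3) H by simp
qed

lemma card_grafts_label_hd:
  assumes d: "distinct (forest_labels (f # F @ [s]))"
  shows "card {G \<in> grafts False s (f # F). y \<in> set (labels (hd G))} =
    (if y \<in> set (labels f) then 2 * length (forest_labels (f # F)) - length (f # F) else 0)
    + (if y \<in> set (labels s) then 2 * length (labels f) - 1 else 0)"
    (is "card ?S = _")
proof -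
  obtain x us where f: "f = Node x us" by (cases f)
  have r: "root s \<notin> set (forest_labels (f # F))"
    using d root_in_labels[of s] by auto
  consider "y \<in> set (labels f)" | "y \<in> set (labels s)" "y \<notin> set (labels f)"
    | "y \<notin> set (labels s)" "y \<notin> set (labels f)" by blast
  then show ?thesis
  proof cases
    case 1
    then have "?S = grafts False s (f # F)" by (auto simp: f set_grafts simp del: set_concat)
    moreover have "y \<notin> set (labels s)" using 1 d by auto
    ultimately show ?thesis using 1 card_grafts[OF r, of False] by simp
  next
    case 2
    \<comment> \<open>The label \<open>y\<close> arrives with \<open>s\<close>, which must go below
      the root \<open>x\<close> of the first tree. As \<open>f\<close> has one label more than
      \<open>us\<close>, the 2 m + 1 places in \<open>us\<close> become
      \<open>2 * length (labels f) - 1\<close>.\<close>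
    then have "?S = (\<lambda>us'. Node x us' # F) ` grafts True s us" by (auto simp: f set_grafts simp del: set_concat)
    then have "card ?S = card (grafts True s us)"
      by (simp add: card_image inj_on_def)
    then show ?thesis using 2 r card_grafts[of s us True] by (simp add: f)
  next
    case 3
    then have "?S = {}" by (auto simp: f set_grafts simp del: set_concat)
    then show ?thesis using 3 by (simp only: card.empty if_False add_0)
  qed
qed

section \<open>Exchanging the children of the first and last roots\<close>

definition swap_end_children :: "'a plane_tree list \<Rightarrow> 'a plane_tree list" where
  "swap_end_children F =
    Node (root (hd F)) (children (last F)) # butlast (tl F)
      @ [Node (root (last F)) (children (hd F))]"

lemma swap_end_children_eq [simp]:
  "swap_end_children (Node x us # F @ [Node z vs]) = Node x vs # F @ [Node z us]"
  by (simp add: swap_end_children_def)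

lemma plane_forests_endsE:
  assumes "H \<in> plane_forests n (Suc k)" "1 \<le> k"
  obtains us F vs where "H = Node 1 us # F @ [Node (Suc k) vs]"
proof -
  obtain H' s where H: "H = H' @ [s]" using assms(1) plane_forests_snocE by blast
  have "map root H' = 1 # [2..<Suc k]" "root s = Suc k"
    using assms unfolding H snoc_in_plane_forests_iff by (auto simp: upt_conv_Cons numeral_2_eq_2 simp del: upt_Suc)
  then obtain f F where "H' = f # F" "root f = 1" "root s = Suc k" by (auto simp: map_eq_Cons_conv)
  then show ?thesis using that H by (cases f, cases s) auto
qed

text \<open>Only the lists of children move, so the sequence of roots is kept and the labels are
  merely permuted.\<close>

lemma swap_end_children_plane_forests:
  assumes "H \<in> plane_forests n (Suc k)" "1 \<le> k"
  shows "swap_end_children H \<in> plane_forests n (Suc k)"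
proof -
  obtain us F vs where H: "H = Node 1 us # F @ [Node (Suc k) vs]"
    using assms by (rule plane_forests_endsE)
  have m: "mset (forest_labels (swap_end_children H)) = mset (forest_labels H)"
    by (simp add: H)
  have "map root (swap_end_children H) = map root H" by (simp add: H)
  then show ?thesis
    using assms(1) mset_eq_imp_distinct_iff[OF m] mset_eq_setD[OF m]
    by (simp add: plane_forests_def)
qed

section \<open>Summation over the forests with k trees\<close>

theorem corollary4p1:
  fixes n k :: nat
  assumes "2 \<le> k" and "k \<le> n - 1"
  shows "card (plane_forests_desc n (k - 1) n 1) = (2 * n - k) * card (plane_forests_desc n k n 1)"
proof -
  obtain j where k: "k = Suc j" and j: "1 \<le> j" using assms(1) by (cases k) auto
  let ?P = "plane_forests n k"
  let ?L = "\<lambda>H. length (labels (last H))"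
  let ?g = "\<lambda>H. {G \<in> grafts False (last H) (butlast H). n \<in> set (labels (hd G))}"
  \<comment> \<open>Without the tree rooted at \<open>k\<close> there remain
    \<open>j = k - 1\<close> trees with \<open>n - ?L H\<close> vertices; this is their number of
    places.\<close>
  let ?a = "\<lambda>H. 2 * (n - ?L H) - j"
  let ?first = "\<lambda>H. n \<in> set (labels (hd H))"
  let ?last = "\<lambda>H. n \<in> set (labels (last H))"
  have fin: "finite ?P" by (rule finite_plane_forests)
  have card_g: "card (?g H) = (if ?first H then ?a H else 0)
      + (if ?last H then 2 * length (labels (hd H)) - 1 else 0)"
    and le: "j + 2 * ?L H \<le> 2 * n" and L: "1 \<le> ?L H" if H: "H \<in> ?P" for H
  proof -
    obtain us F vs where H': "H = Node 1 us # F @ [Node k vs]"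
      using H j plane_forests_endsE unfolding k by blast
    let ?f = "Node 1 us"
    have d: "distinct (forest_labels (?f # F @ [Node k vs]))"
      using H by (simp add: plane_forests_def H')
    have "length (forest_labels H) = n"
      using H distinct_card[of "forest_labels H"] by (simp add: plane_forests_def)
    then have n: "length (forest_labels (?f # F)) = n - ?L H" "?L H \<le> n" by (auto simp: H')
    have "length (map root H) = k" using H by (simp add: plane_forests_def)
    then have len: "length (?f # F) = j" by (simp add: H' k)
    have bl: "butlast H = ?f # F" "last H = Node k vs" "hd H = ?f" by (simp_all add: H')
    show "card (?g H) = (if ?first H then ?a H else 0)
        + (if ?last H then 2 * length (labels (hd H)) - 1 else 0)"
      using card_grafts_label_hd[OF d, of n] unfolding bl n(1)[symmetric, unfolded bl] len .
    \<comment> \<open>Each tree has a vertex, so the \<open>j\<close> remaining trees have at least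
      \<open>j\<close> labels and the subtraction in \<open>?a\<close> is not truncated.\<close>
    have "length F \<le> length (forest_labels F)"
    proof (induction F)
      case (Cons t ts)
      then show ?case by (cases t) simp
    qed simp
    then show "j + 2 * ?L H \<le> 2 * n" using len n by simp
    show "1 \<le> ?L H" by (simp add: H')
  qed
  have "plane_forests_desc n (k - 1) n 1 = (\<Union>H\<in>?P. ?g H)"
    using plane_forests_desc_eq[OF j, of n n] plane_forests_eq_UN_grafts[of j n] assms
    by (auto simp: k)
  also have "card \<dots> = (\<Sum>H\<in>?P. card (?g H))"
    using grafts_plane_forests_disjoint[of _ n j]
    by (intro card_UN_disjoint fin) (auto simp: finite_grafts k)
  also have "\<dots> = (\<Sum>H\<in>?P. (if ?first H then ?a H else 0)
      + (if ?last H then 2 * length (labels (hd H)) - 1 else 0))"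
    by (intro sum.cong refl card_g)
  also have "\<dots> = (\<Sum>H | H \<in> ?P \<and> ?first H. ?a H)
      + (\<Sum>H | H \<in> ?P \<and> ?last H. 2 * length (labels (hd H)) - 1)"
    by (simp only: sum.distrib sum.inter_filter[OF fin])
  also have "(\<Sum>H | H \<in> ?P \<and> ?last H. 2 * length (labels (hd H)) - 1)
      = (\<Sum>H | H \<in> ?P \<and> ?first H. 2 * ?L H - 1)"
  proof -
    \<comment> \<open>As \<open>n\<close> exceeds both 1 and \<open>k\<close>, it is neither end
      root and moves with the children. Each end tree has one vertex more than its list of children,
      so the two sizes are exchanged as well.\<close>
    have *: "swap_end_children (swap_end_children H) = H \<and> swap_end_children H \<in> ?P
        \<and> ?first (swap_end_children H) = ?last H \<and> ?last (swap_end_children H) = ?first H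
        \<and> length (labels (hd H)) = ?L (swap_end_children H)" if H: "H \<in> ?P" for H
    proof -
      obtain us F vs where H': "H = Node 1 us # F @ [Node k vs]"
        using H j plane_forests_endsE unfolding k by blast
      show ?thesis
        using swap_end_children_plane_forests[of H n j] H j assms by (auto simp: H' k)
    qed
    show ?thesis
      by (rule sum.reindex_bij_witness[where i = swap_end_children and j = swap_end_children])
        (use * in auto)
  qed
  also have "(\<Sum>H | H \<in> ?P \<and> ?first H. ?a H) + (\<Sum>H | H \<in> ?P \<and> ?first H. 2 * ?L H - 1)
      = (\<Sum>H | H \<in> ?P \<and> ?first H. 2 * n - k)"
    unfolding sum.distrib[symmetric]
  proof (intro sum.cong refl)
    fix H assume "H \<in> {H \<in> ?P. ?first H}"
    then have "j + 2 * ?L H \<le> 2 * n" "1 \<le> ?L H" using le L by auto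
    \<comment> \<open>The size of the last tree cancels, leaving 2 n - (j + 1).\<close>
    then show "?a H + (2 * ?L H - 1) = 2 * n - k" by (simp add: k)
  qed
  also have "\<dots> = (2 * n - k) * card (plane_forests_desc n k n 1)"
    using plane_forests_desc_eq[of k n n] by (simp add: k)
  finally show ?thesis .
qed

end
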